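(* Let $f,g\colon\mathbb{C}\to\mathbb{C}$ be nonconstant entire functions such that $0$ is a fixed point of $g$ belonging to the Fatou set of $g$, and let $U$ be a Fatou component of $f$. Assume that there exist $z_0\in U$ and a strictly increasing sequence $(n_k)_{k\in\mathbb{N}}$ of natural numbers with $f^{n_k}(z_0)\to\infty$ as $k\to\infty$. Then there exists an entire function $h\colon\mathbb{C}\to\mathbb{C}$ such that the Fatou component $U$ does not bulge (for each of the three notions of normality: $\widehat{\mathbb{C}^2}$, $\mathbf{P}_2\mathbb{C}$ and $\widehat{\mathbb{C}}\times\widehat{\mathbb{C}}$) for the skew-product $F\colon\mathbb{C}^2\to\mathbb{C}^2$, $$F(z,w)=(f(z)+w\,h(z),\,g(w)).$$
   Context: $f^n$ denotes the $n$-th iterate; $\mathbb{N}$ includes $0$. The Fatou set of an entire function of one variable is the set of normality (with values in the Riemann sphere) of its iterates; its connected components are called Fatou components. Let $X$ be a complex manifold and let $\mathcal{F}$ be a family of holomorphic maps $X\to\mathbb{C}^2$. - $\mathcal{F}$ is $\widehat{\mathbb{C}^2}$-normal if every sequence in $\mathcal{F}$ either diverges uniformly to infinity on compact subsets of $X$ or has a subsequence converging uniformly on compact subsets to a holomorphic map $X\to\mathbb{C}^2$. (Here $\widehat{\mathbb{C}^2}$ is the one-point compactification.) - $\mathcal{F}$ is $\mathbf{P}_2\mathbb{C}$-normal if every sequence in $\mathcal{F}$ has a subsequence converging uniformly on compact subsets to a holomorphic map $X\to\mathbf{P}_2\mathbb{C}$ (with $\mathbb{C}^2\subset\mathbf{P}_2\mathbb{C}$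 the complex projective plane). - $\mathcal{F}$ is $(\widehat{\mathbb{C}})^2$-normal if every sequence in $\mathcal{F}$ has a subsequence converging uniformly on compact subsets to a holomorphic map $X\to\widehat{\mathbb{C}}\times\widehat{\mathbb{C}}$. For a holomorphic map $F\colon\mathbb{C}^2\to\mathbb{C}^2$ and any of these notions, the Fatou set of $F$ is the set of points having an open neighborhood on which the family of iterates $(F^n)_{n\in\mathbb{N}}$ is normal. When no notion is specified, statements are meant for all three. Bulging: for a skew-product $F(z,w)=(f(z)+w\,h(z,w),g(w))$ with $f,g,h$ entire and $0$ a fixed point of $g$ in the Fatou set of $g$, a Fatou component $U\subset\mathbb{C}$ of $f$ is called bulging (with respect to a given notion of normality) if $U\times\{0\}$ is contained in the corresponding Fatou set of $F$. *)

theory Defs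
  imports "HOL-Complex_Analysis.Complex_Analysis"
begin

section \<open>The Riemann sphere\<close>

datatype sphere = Fin complex | Infinity

text \<open>Inverse of the stereographic projection, onto the unit sphere of \<open>\<complex> \<times> \<real>\<close>;
  the metric below is therefore the chordal one.\<close>

fun stereo :: "sphere \<Rightarrow> complex \<times> real" where
  "stereo (Fin z) = (of_real (2 / (1 + (cmod z)\<^sup>2)) * z, ((cmod z)\<^sup>2 - 1) / ((cmod z)\<^sup>2 + 1))"
| "stereo Infinity = (0, 1)"

lemma stereo_inject: "stereo p = stereo q \<longleftrightarrow> p = q"
proof
  have pos: "1 + (cmod z)\<^sup>2 > 0" for z
    by (metis add_pos_nonneg zero_le_power2 zero_less_one)
  have snd_lt: "((cmod z)\<^sup>2 - 1) / ((cmod z)\<^sup>2 + 1) = 1 - 2 / (1 + (cmod z)\<^sup>2)" for z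
    using pos[of z] by (simp add: field_simps)
  have nz: "2 / (1 + (cmod z)\<^sup>2) \<noteq> 0" for z
    using pos[of z] by simp
  assume eq: "stereo p = stereo q"
  show "p = q"
  proof (cases p; cases q)
    fix z w assume p: "p = Fin z" and q: "q = Fin w"
    from eq have "2 / (1 + (cmod z)\<^sup>2) = 2 / (1 + (cmod w)\<^sup>2)"
      by (simp add: p q snd_lt)
    moreover from eq have "of_real (2 / (1 + (cmod z)\<^sup>2)) * z = of_real (2 / (1 + (cmod w)\<^sup>2)) * w"
      by (simp add: p q)
    ultimately have "of_real (2 / (1 + (cmod w)\<^sup>2)) * z = of_real (2 / (1 + (cmod w)\<^sup>2)) * w"
      by simp
    moreover have "complex_of_real (2 / (1 + (cmod w)\<^sup>2)) \<noteq> 0"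
      using nz[of w] by (simp only: of_real_eq_0_iff not_False_eq_True)
    ultimately show "p = q"
      using p q by (metis mult_left_cancel)
  qed (use eq nz in \<open>auto simp: snd_lt\<close>)
qed simp

instantiation sphere :: metric_space
begin

definition dist_sphere :: "sphere \<Rightarrow> sphere \<Rightarrow> real" where
  "dist_sphere p q = dist (stereo p) (stereo q)"

definition uniformity_sphere :: "(sphere \<times> sphere) filter" where
  "uniformity_sphere = (INF e\<in>{0<..}. principal {(p, q). dist p q < e})"

definition open_sphere :: "sphere set \<Rightarrow> bool" where
  "open_sphere V \<longleftrightarrow> (\<forall>p\<in>V. \<forall>\<^sub>F (p', q) in uniformity. p' = p \<longrightarrow> q \<in> V)"

instance
  by standard
    (auto simp: dist_sphere_def uniformity_sphere_def open_sphere_def stereo_inject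
          intro: dist_triangle2)

end

text \<open>Inverse of the chart \<open>p \<mapsto> 1/p\<close> centred at infinity.\<close>

definition inv_chart :: "complex \<Rightarrow> sphere" where
  "inv_chart u = (if u = 0 then Infinity else Fin (1 / u))"


section \<open>The complex projective plane\<close>

quotient_type cp2 = "complex ^ 3" / partial:
  "\<lambda>u v. u \<noteq> 0 \<and> v \<noteq> 0 \<and> (\<exists>c. c \<noteq> 0 \<and> u = c *s v)"
  morphisms rep_cp2 homog
proof (rule part_equivpI)
  show "\<exists>u::complex^3. u \<noteq> 0 \<and> u \<noteq> 0 \<and> (\<exists>c. c \<noteq> 0 \<and> u = c *s u)"
    by (rule exI[of _ "axis 1 1"]) (auto intro!: exI[of _ 1])
  show "symp (\<lambda>u v::complex^3. u \<noteq> 0 \<and> v \<noteq> 0 \<and> (\<exists>c. c \<noteq> 0 \<and> u = c *s v))"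
  proof (rule sympI, elim conjE exE, intro conjI)
    fix u v :: "complex^3" and c :: complex
    assume "c \<noteq> 0" "u = c *s v"
    then show "\<exists>d. d \<noteq> 0 \<and> v = d *s u"
      by (intro exI[of _ "1 / c"]) simp
  qed
  show "transp (\<lambda>u v::complex^3. u \<noteq> 0 \<and> v \<noteq> 0 \<and> (\<exists>c. c \<noteq> 0 \<and> u = c *s v))"
  proof (rule transpI, elim conjE exE, intro conjI)
    fix u v w :: "complex^3" and c d :: complex
    assume "c \<noteq> 0" "d \<noteq> 0" "u = c *s v" "v = d *s w"
    then show "\<exists>e. e \<noteq> 0 \<and> u = e *s w"
      by (intro exI[of _ "c * d"]) simp
  qed
qed

text \<open>The matrix of the orthogonal projection of \<open>\<complex>\<^sup>3\<close> onto the line spanned by \<open>v\<close>.\<close>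

lift_definition line_projection :: "cp2 \<Rightarrow> complex ^ 3 ^ 3"
  is "\<lambda>v. \<chi> i j. v $ i * cnj (v $ j) / of_real ((norm v)\<^sup>2)"
proof -
  fix u v :: "complex^3"
  assume "u \<noteq> 0 \<and> v \<noteq> 0 \<and> (\<exists>c. c \<noteq> 0 \<and> u = c *s v)"
  then obtain c where u: "u = c *s v" and c: "c \<noteq> 0"
    by blast
  have n: "norm (c *s v) = cmod c * norm v"
    by (simp add: norm_vec_def L2_set_def norm_mult power_mult_distrib
                  flip: sum_distrib_left add: real_sqrt_mult)
  have "(complex_of_real (cmod c))\<^sup>2 = c * cnj c"
    by (metis complex_norm_square of_real_power)
  then show "(\<chi> i j. u $ i * cnj (u $ j) / of_real ((norm u)\<^sup>2)) =
             (\<chi> i j. v $ i * cnj (v $ j) / of_real ((norm v)\<^sup>2))"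
    using c by (simp add: u n power_mult_distrib vec_eq_iff)
qed

lemma line_projection_inject: "line_projection p = line_projection q \<longleftrightarrow> p = q"
proof
  show "line_projection p = line_projection q \<Longrightarrow> p = q"
  proof transfer
    fix u v :: "complex^3"
    assume "u \<noteq> 0 \<and> u \<noteq> 0 \<and> (\<exists>c. c \<noteq> 0 \<and> u = c *s u)"
      and "v \<noteq> 0 \<and> v \<noteq> 0 \<and> (\<exists>c. c \<noteq> 0 \<and> v = c *s v)"
      and eq: "(\<chi> i j. u $ i * cnj (u $ j) / of_real ((norm u)\<^sup>2)) =
               (\<chi> i j. v $ i * cnj (v $ j) / of_real ((norm v)\<^sup>2))"
    then have u: "u \<noteq> 0" and v: "v \<noteq> 0" by auto
    from u obtain j where j: "u $ j \<noteq> 0" by (auto simp: vec_eq_iff)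
    define c where "c = cnj (v $ j) / (complex_of_real (norm v))\<^sup>2
                        * (complex_of_real (norm u))\<^sup>2 / cnj (u $ j)"
    have *: "u $ i * cnj (u $ j) / (complex_of_real (norm u))\<^sup>2 =
             v $ i * cnj (v $ j) / (complex_of_real (norm v))\<^sup>2" for i
      using eq by (simp add: vec_eq_iff)
    have "u = c *s v"
      using * j u v by (simp add: vec_eq_iff c_def field_simps)
    moreover from this u have "c \<noteq> 0" by auto
    ultimately show "u \<noteq> 0 \<and> v \<noteq> 0 \<and> (\<exists>c. c \<noteq> 0 \<and> u = c *s v)"
      using u v by blast
  qed
qed simp

text \<open>Since the projective plane is compact, uniform convergence does not depend on the choice
  of a metric inducing its topology; this one is the Frobenius distance of projections,
  \<open>\<surd>2\<close> times the sine of the angle between the two lines.\<close>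

instantiation cp2 :: metric_space
begin

definition dist_cp2 :: "cp2 \<Rightarrow> cp2 \<Rightarrow> real" where
  "dist_cp2 p q = dist (line_projection p) (line_projection q)"

definition uniformity_cp2 :: "(cp2 \<times> cp2) filter" where
  "uniformity_cp2 = (INF e\<in>{0<..}. principal {(p, q). dist p q < e})"

definition open_cp2 :: "cp2 set \<Rightarrow> bool" where
  "open_cp2 V \<longleftrightarrow> (\<forall>p\<in>V. \<forall>\<^sub>F (p', q) in uniformity. p' = p \<longrightarrow> q \<in> V)"

instance
  by standard
    (auto simp: dist_cp2_def uniformity_cp2_def open_cp2_def line_projection_inject
          intro: dist_triangle2)

end

definition affine_point :: "complex \<times> complex \<Rightarrow> cp2" where
  "affine_point = (\<lambda>(z, w). homog (vector [1, z, w]))"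


section \<open>Holomorphic maps\<close>

text \<open>Complex differentiability in two variables. This and the notions below are only meant
  for an open set \<open>X\<close>.\<close>

definition holomorphic2_on :: "(complex \<times> complex \<Rightarrow> complex) \<Rightarrow> (complex \<times> complex) set \<Rightarrow> bool" where
  "holomorphic2_on u X \<longleftrightarrow>
     (\<forall>p\<in>X. \<exists>a b. (u has_derivative (\<lambda>(x, y). a * x + b * y)) (at p))"

definition holomorphic_to_C2 :: "(complex \<times> complex \<Rightarrow> complex \<times> complex) \<Rightarrow> (complex \<times> complex) set \<Rightarrow> bool" where
  "holomorphic_to_C2 \<phi> X \<longleftrightarrow>
     holomorphic2_on (\<lambda>x. fst (\<phi> x)) X \<and> holomorphic2_on (\<lambda>x. snd (\<phi> x)) X"

text \<open>The parameter \<open>hol\<close> is the notion of holomorphic function on the source, which is a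
  domain in \<open>\<complex>\<close> or in \<open>\<complex>\<^sup>2\<close>.\<close>

definition holomorphic_to_sphere ::
    "(('a::topological_space \<Rightarrow> complex) \<Rightarrow> 'a set \<Rightarrow> bool) \<Rightarrow> ('a \<Rightarrow> sphere) \<Rightarrow> 'a set \<Rightarrow> bool" where
  "holomorphic_to_sphere hol \<phi> X \<longleftrightarrow>
     (\<forall>p\<in>X. \<exists>V u. open V \<and> p \<in> V \<and> V \<subseteq> X \<and> hol u V \<and>
        ((\<forall>x\<in>V. \<phi> x = Fin (u x)) \<or> (\<forall>x\<in>V. \<phi> x = inv_chart (u x))))"

text \<open>In the chart of points with nonzero \<open>i\<close>-th homogeneous coordinate, that coordinate is
  normalised to 1 and the other two are the affine coordinates.\<close>

definition holomorphic_to_cp2 :: "(complex \<times> complex \<Rightarrow> cp2) \<Rightarrow> (complex \<times> complex) set \<Rightarrow> bool" where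
  "holomorphic_to_cp2 \<phi> X \<longleftrightarrow>
     (\<forall>p\<in>X. \<exists>V u i. open V \<and> p \<in> V \<and> V \<subseteq> X \<and>
        (\<forall>j. holomorphic2_on (\<lambda>x. u x $ j) V) \<and>
        (\<forall>x\<in>V. u x $ i = 1) \<and> (\<forall>x\<in>V. \<phi> x = homog (u x)))"

definition holomorphic_to_sphere2 ::
    "(complex \<times> complex \<Rightarrow> sphere \<times> sphere) \<Rightarrow> (complex \<times> complex) set \<Rightarrow> bool" where
  "holomorphic_to_sphere2 \<phi> X \<longleftrightarrow>
     holomorphic_to_sphere holomorphic2_on (\<lambda>x. fst (\<phi> x)) X \<and>
     holomorphic_to_sphere holomorphic2_on (\<lambda>x. snd (\<phi> x)) X"


section \<open>Normal families\<close>

text \<open>In the definitions of normality the members of the family are total functions, of which only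
  the restrictions to \<open>X\<close> matter.\<close>

definition compact_limit ::
    "'a::topological_space set \<Rightarrow> (nat \<Rightarrow> 'a \<Rightarrow> 'b::metric_space) \<Rightarrow> ('a \<Rightarrow> 'b) \<Rightarrow> bool" where
  "compact_limit X s \<phi> \<longleftrightarrow> (\<forall>K. compact K \<and> K \<subseteq> X \<longrightarrow> uniform_limit K s \<phi> sequentially)"

definition compactly_divergent ::
    "'a::topological_space set \<Rightarrow> (nat \<Rightarrow> 'a \<Rightarrow> 'b::real_normed_vector) \<Rightarrow> bool" where
  "compactly_divergent X s \<longleftrightarrow>
     (\<forall>K. compact K \<and> K \<subseteq> X \<longrightarrow> (\<forall>R. \<forall>\<^sub>F n in sequentially. \<forall>x\<in>K. norm (s n x) > R))"

definition sphere_normal :: "complex set \<Rightarrow> (complex \<Rightarrow> complex) set \<Rightarrow> bool" where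
  "sphere_normal X \<F> \<longleftrightarrow>
     (\<forall>s. range s \<subseteq> \<F> \<longrightarrow>
        (\<exists>r \<phi>. strict_mono (r :: nat \<Rightarrow> nat) \<and> holomorphic_to_sphere (holomorphic_on) \<phi> X \<and>
               compact_limit X (\<lambda>n x. Fin (s (r n) x)) \<phi>))"

definition C2hat_normal ::
    "(complex \<times> complex) set \<Rightarrow> (complex \<times> complex \<Rightarrow> complex \<times> complex) set \<Rightarrow> bool" where
  "C2hat_normal X \<F> \<longleftrightarrow>
     (\<forall>s. range s \<subseteq> \<F> \<longrightarrow>
        compactly_divergent X s \<or>
        (\<exists>r \<phi>. strict_mono (r :: nat \<Rightarrow> nat) \<and> holomorphic_to_C2 \<phi> X \<and>
               compact_limit X (\<lambda>n. s (r n)) \<phi>))"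

definition P2_normal ::
    "(complex \<times> complex) set \<Rightarrow> (complex \<times> complex \<Rightarrow> complex \<times> complex) set \<Rightarrow> bool" where
  "P2_normal X \<F> \<longleftrightarrow>
     (\<forall>s. range s \<subseteq> \<F> \<longrightarrow>
        (\<exists>r \<phi>. strict_mono (r :: nat \<Rightarrow> nat) \<and> holomorphic_to_cp2 \<phi> X \<and>
               compact_limit X (\<lambda>n x. affine_point (s (r n) x)) \<phi>))"

definition Chat2_normal ::
    "(complex \<times> complex) set \<Rightarrow> (complex \<times> complex \<Rightarrow> complex \<times> complex) set \<Rightarrow> bool" where
  "Chat2_normal X \<F> \<longleftrightarrow>
     (\<forall>s. range s \<subseteq> \<F> \<longrightarrow>
        (\<exists>r \<phi>. strict_mono (r :: nat \<Rightarrow> nat) \<and> holomorphic_to_sphere2 \<phi> X \<and>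
               compact_limit X (\<lambda>n x. map_prod Fin Fin (s (r n) x)) \<phi>))"


section \<open>Fatou sets and bulging\<close>

definition Fatou_set ::
    "('a::topological_space set \<Rightarrow> ('a \<Rightarrow> 'a) set \<Rightarrow> bool) \<Rightarrow> ('a \<Rightarrow> 'a) \<Rightarrow> 'a set" where
  "Fatou_set nrml F = {p. \<exists>V. open V \<and> p \<in> V \<and> nrml V (range (\<lambda>n. F ^^ n))}"

definition bulging ::
    "((complex \<times> complex) set \<Rightarrow> (complex \<times> complex \<Rightarrow> complex \<times> complex) set \<Rightarrow> bool)
       \<Rightarrow> (complex \<times> complex \<Rightarrow> complex \<times> complex) \<Rightarrow> complex set \<Rightarrow> bool" where
  "bulging nrml F U \<longleftrightarrow> U \<times> {0} \<subseteq> Fatou_set nrml F"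

end

theory Submission
  imports Defs
begin

text \<open>The entire function \<open>h\<close> is a limit of successive perturbations. At stage \<open>k\<close> one picks a time
  \<open>n\<close> with \<open>f\<^sup>n(z\<^sub>0)\<close> large and a tiny \<open>w\<close> with \<open>g\<^sup>n\<^sup>-\<^sup>1(w) \<noteq> 0\<close>, whose orbit follows that of
  \<open>z\<^sub>0\<close> closely, and adds to \<open>h\<close> a polynomial that is small on a large disc, vanishes on all
  orbit points used so far and sends the orbit of \<open>(z\<^sub>0, w)\<close> to first coordinate \<open>0\<close> at time \<open>n\<close>.
  Thus arbitrarily close to \<open>(z\<^sub>0, 0)\<close> there are points whose image under \<open>F\<^sup>n\<close> stays in a bounded part
  of \<open>{0} \<times> \<complex>\<close> while \<open>F\<^sup>n(z\<^sub>0, 0) = (f\<^sup>n(z\<^sub>0), 0)\<close> tends to infinity, so the iterates are not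
  equicontinuous at \<open>(z\<^sub>0, 0)\<close> in any of the three compactifications.\<close>

section \<open>Iterates of skew-products and their dependence on \<open>h\<close>\<close>

definition skew_product ::
    "(complex \<Rightarrow> complex) \<Rightarrow> (complex \<Rightarrow> complex) \<Rightarrow> (complex \<Rightarrow> complex) \<Rightarrow>
      complex \<times> complex \<Rightarrow> complex \<times> complex" where
  "skew_product f g h = (\<lambda>(z, w). (f z + w * h z, g w))"

lemma snd_skew_product_funpow: "snd ((skew_product f g h ^^ n) p) = (g ^^ n) (snd p)"
  by (induction n) (auto simp: skew_product_def split: prod.splits)

lemma skew_product_funpow_Suc:
  "(skew_product f g h ^^ Suc n) p =
    (f (fst ((skew_product f g h ^^ n) p)) + (g ^^ n) (snd p) * h (fst ((skew_product f g h ^^ n) p)),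
     (g ^^ Suc n) (snd p))"
  using snd_skew_product_funpow[of n f g h p] by (simp add: skew_product_def split_beta)

lemma skew_product_funpow_invariant_line:
  assumes "g 0 = 0"
  shows "(skew_product f g h ^^ n) (z, 0) = ((f ^^ n) z, 0)"
  by (induction n) (auto simp: skew_product_def assms)

text \<open>The first \<open>n\<close> steps evaluate \<open>h\<close> only at the first coordinates
  of the first \<open>n\<close> orbit points. Later corrections of \<open>h\<close> that vanish at
  these points therefore leave an orbit already built intact.\<close>

lemma skew_product_funpow_cong:
  assumes "\<And>j. j < n \<Longrightarrow> h (fst ((skew_product f g h ^^ j) p)) = h' (fst ((skew_product f g h ^^ j) p))"
  shows "(skew_product f g h ^^ n) p = (skew_product f g h' ^^ n) p"
  using assms
proof (induction n)
  case (Suc n)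
  then have "(skew_product f g h ^^ n) p = (skew_product f g h' ^^ n) p"
    by simp
  with Suc.prems[of n] show ?case
    by (metis lessI skew_product_funpow_Suc)
qed simp

lemma continuous_on_funpow:
  fixes F :: "'a::topological_space \<Rightarrow> 'a"
  assumes "continuous_on UNIV F"
  shows "continuous_on UNIV (F ^^ n)"
proof (induction n)
  case (Suc n)
  then show ?case
    using continuous_on_compose[of UNIV "F ^^ n" F] assms continuous_on_subset by auto
qed (simp add: id_def)

lemma continuous_on_skew_product:
  assumes "continuous_on UNIV f" "continuous_on UNIV g" "continuous_on UNIV h"
  shows "continuous_on UNIV (skew_product f g h)"
  unfolding skew_product_def split_beta
  by (intro continuous_intros continuous_on_compose2[OF assms(1)]
        continuous_on_compose2[OF assms(2)] continuous_on_compose2[OF assms(3)]) auto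

section \<open>Iterates in one variable\<close>

text \<open>Zeros of a nonconstant entire function are isolated, so near 0 the map \<open>g\<close>
  tends to 0 without taking the value 0. Phrased as a limit from \<open>at 0\<close> to
  \<open>at 0\<close>, this passes to compositions.\<close>

lemma eventually_funpow_nonzero:
  fixes g :: "complex \<Rightarrow> complex"
  assumes g: "g holomorphic_on UNIV" and nc: "\<not> g constant_on UNIV" and g0: "g 0 = 0"
  shows "\<forall>\<^sub>F w in at 0. (g ^^ n) w \<noteq> 0"
proof -
  have "isCont g 0"
    using holomorphic_on_imp_continuous_on[OF g] by (simp add: continuous_on_eq_continuous_at)
  then have lim: "g \<midarrow>0\<rightarrow> 0"
    using g0 by (simp add: isCont_def)
  obtain \<beta> where "g \<beta> \<noteq> 0"
    using nc by (metis UNIV_I constant_on_def)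
  then obtain r where r: "0 < r" "\<And>z. z \<in> ball 0 r - {0} \<Longrightarrow> g z \<noteq> 0"
    using isolated_zeros[OF g open_UNIV connected_UNIV UNIV_I g0 UNIV_I] by blast
  then have ev: "\<forall>\<^sub>F w in at 0. g w \<noteq> 0"
    unfolding eventually_at by (intro exI[of _ r]) (auto simp: dist_commute)
  have fl: "filterlim g (at 0) (at 0)"
    using lim ev by (simp add: filterlim_at)
  have "filterlim (g ^^ n) (at 0) (at 0)"
  proof (induction n)
    case 0
    then show ?case by (simp add: filterlim_ident id_def)
  next
    case (Suc n)
    then show ?case using filterlim_compose[OF fl Suc] by (simp add: o_def)
  qed
  then show ?thesis
    by (simp add: filterlim_at)
qed

text \<open>A repetition makes the orbit eventually periodic, hence finite. Injectivity later
  separates the point where \<open>h\<close> is corrected from the earlier orbit points.\<close>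

lemma unbounded_orbit_inj:
  fixes f :: "'a::metric_space \<Rightarrow> 'a"
  assumes unb: "\<not> bounded (range (\<lambda>n. (f ^^ n) z))"
  shows "inj (\<lambda>n. (f ^^ n) z)"
proof (rule ccontr)
  assume "\<not> ?thesis"
  then obtain i j where ij: "i < j" "(f ^^ i) z = (f ^^ j) z"
    by (metis injI linorder_neqE_nat)
  have "(f ^^ m) z \<in> (\<lambda>n. (f ^^ n) z) ` {..<j}" for m
  proof (induction m rule: less_induct)
    case (less m)
    show ?case
    proof (cases "m < j")
      case False
      \<comment> \<open>Since \<open>i < j\<close>, the index \<open>m - j + i\<close> is smaller
        than \<open>m\<close>, so the induction hypothesis applies to it.\<close>
      then have "(f ^^ m) z = (f ^^ (m - j)) ((f ^^ j) z)"
        by (metis comp_apply funpow_add le_add_diff_inverse2 not_less)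
      also have "\<dots> = (f ^^ (m - j + i)) z"
        using ij by (simp add: funpow_add)
      finally show ?thesis
        using less[of "m - j + i"] ij False by simp
    qed auto
  qed
  then have "range (\<lambda>n. (f ^^ n) z) \<subseteq> (\<lambda>n. (f ^^ n) z) ` {..<j}"
    by blast
  then have "bounded (range (\<lambda>n. (f ^^ n) z))"
    by (meson finite_imageI finite_imp_bounded finite_lessThan bounded_subset)
  with unb show False ..
qed

section \<open>Polynomial corrections of \<open>h\<close>\<close>

text \<open>A Lagrange polynomial has the right values on \<open>T\<close> and at \<open>a\<close>.
  The factor \<open>(z / a) ^ N\<close> preserves them, and for large \<open>N\<close> it makes the
  product small on the disc of radius \<open>R < cmod a\<close>.\<close>

lemma small_polynomial_interpolation:
  fixes a v :: complex
  assumes T: "finite T" "a \<notin> T" and R: "0 \<le> R" "R < cmod a" and e: "0 < e"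
  obtains p where "p holomorphic_on UNIV" "\<And>z. z \<in> T \<Longrightarrow> p z = 0" "p a = v"
    "\<And>z. cmod z \<le> R \<Longrightarrow> cmod (p z) \<le> e"
proof -
  define q where "q = (\<lambda>z. v * (\<Prod>t\<in>T. (z - t) / (a - t)))"
  have q: "q holomorphic_on UNIV"
    unfolding q_def by (intro holomorphic_intros) (use T in auto)
  have "continuous_on (cball 0 R) q"
    by (rule holomorphic_on_imp_continuous_on[OF holomorphic_on_subset[OF q]]) auto
  then obtain B' where "\<And>z. z \<in> cball 0 R \<Longrightarrow> cmod (q z) \<le> B'"
    using continuous_on_compact_bound[OF compact_cball] by blast
  then obtain B where B: "B > 0" "\<And>z. cmod z \<le> R \<Longrightarrow> cmod (q z) \<le> B"
    by (metis less_max_iff_disj max.coboundedI1 mem_cball_0 zero_less_one)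
  have a: "a \<noteq> 0" using R by auto
  have "(\<lambda>N. (R / cmod a) ^ N) \<longlonglongrightarrow> 0"
    using R by (intro LIMSEQ_power_zero) (simp add: a divide_less_eq)
  then have "\<forall>\<^sub>F N in sequentially. (R / cmod a) ^ N < e / B"
    using e B by (intro order_tendstoD) auto
  then obtain N where N: "(R / cmod a) ^ N < e / B"
    using eventually_happens'[OF sequentially_bot] by blast
  show thesis
  proof
    show "(\<lambda>z. (z / a) ^ N * q z) holomorphic_on UNIV"
      by (intro holomorphic_intros q) (use a in auto)
    show "(z / a) ^ N * q z = 0" if "z \<in> T" for z
      using that T by (auto simp: q_def)
    show "(a / a) ^ N * q a = v"
    proof -
      have "(\<Prod>t\<in>T. (a - t) / (a - t)) = 1"
        using T by (intro prod.neutral) auto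
      then show ?thesis
        using a by (simp add: q_def)
    qed
    show "cmod ((z / a) ^ N * q z) \<le> e" if "cmod z \<le> R" for z
    proof -
      have "cmod ((z / a) ^ N * q z) = (cmod z / cmod a) ^ N * cmod (q z)"
        by (simp add: norm_mult norm_power norm_divide)
      also have "\<dots> \<le> (R / cmod a) ^ N * B"
        using that B R by (intro mult_mono power_mono divide_right_mono) auto
      also have "\<dots> \<le> e / B * B"
        using N B by (intro mult_right_mono) auto
      finally show ?thesis
        using B by simp
    qed
  qed
qed

text \<open>The last step of the orbit is corrected by prescribing \<open>h\<close> at the preceding orbit point, which
  lies far out and so can be separated from the disc on which \<open>h\<close> may hardly change.\<close>

lemma perturb_orbit_to_zero:
  fixes f g h :: "complex \<Rightarrow> complex"
  assumes f: "f holomorphic_on UNIV" and g: "g holomorphic_on UNIV" "\<not> g constant_on UNIV"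
    and g0: "g 0 = 0"
    and unb: "\<not> bounded (range (\<lambda>n. (f ^^ n) z))"
    and h: "h holomorphic_on UNIV" and T: "finite T" and e: "0 < e"
  obtains h' n w where "h' holomorphic_on UNIV" "\<And>z. z \<in> T \<Longrightarrow> h' z = h z"
    "\<And>z. cmod z \<le> R \<Longrightarrow> cmod (h' z - h z) \<le> e"
    "cmod w < e" "R \<le> cmod ((f ^^ n) z)" "cmod ((g ^^ n) w) \<le> 1"
    "fst ((skew_product f g h' ^^ n) (z, w)) = 0"
proof -
  let ?F = "skew_product f g h"
  define a where "a = (\<lambda>n. (f ^^ n) z)"
  note cont = f[THEN holomorphic_on_imp_continuous_on] g(1)[THEN holomorphic_on_imp_continuous_on]
    h[THEN holomorphic_on_imp_continuous_on]
  \<comment> \<open>The disc is enlarged to contain \<open>T\<close>, so that any point outside it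
    is automatically not in \<open>T\<close>.\<close>
  obtain R' where R': "R' > 0" "R \<le> R'" "\<And>t. t \<in> T \<Longrightarrow> cmod t \<le> R'"
  proof -
    obtain B where "B > 0" "\<And>t. t \<in> T \<Longrightarrow> cmod t \<le> B"
      using finite_imp_bounded[OF T] bounded_pos by blast
    then show thesis by (intro that[of "max R B"]) (auto simp: le_max_iff_disj)
  qed
  obtain B where "\<And>x. x \<in> cball 0 R' \<Longrightarrow> cmod (f x) \<le> B"
    using continuous_on_compact_bound[OF compact_cball continuous_on_subset[OF cont(1)]] by blast
  then have B: "cmod (f x) \<le> B" if "cmod x \<le> R'" for x
    using that by simp
  \<comment> \<open>Exceeding \<open>cmod z\<close> forces \<open>n > 0\<close>, exceeding
    \<open>B\<close> forces the preceding orbit point out of the disc of radius \<open>R'\<close>,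
    and exceeding \<open>R'\<close> gives the required growth.\<close>
  have "\<exists>n. \<not> cmod (a n) \<le> max (cmod z) (max B R')"
    using unb unfolding bounded_iff a_def by blast
  then obtain n where n: "cmod (a n) > max (cmod z) (max B R')"
    by (auto simp only: not_le)
  then obtain m where m: "n = Suc m"
    by (cases n) (auto simp: a_def)
  have am: "cmod (a m) > R'"
    using B[of "a m"] n m by (auto simp: a_def not_le[symmetric])
  have inj: "inj a"
    unfolding a_def by (rule unbounded_orbit_inj[OF unb])
  define x where "x = (\<lambda>j w. fst ((?F ^^ j) (z, w)))"
  have x_cont: "isCont (x j) 0" for j
  proof -
    have "continuous_on UNIV (x j)"
      unfolding x_def
      by (intro continuous_on_fst continuous_on_compose2[OF continuous_on_funpow[OF continuous_on_skew_product[OF cont]]]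
            continuous_intros) auto
    then show ?thesis by (simp add: continuous_on_eq_continuous_at)
  qed
  \<comment> \<open>At \<open>w = 0\<close> the orbit of \<open>(z, w)\<close> is that of
    \<open>z\<close> under \<open>f\<close>, so open conditions satisfied by the points
    \<open>a j\<close> pass to \<open>x j w\<close> for small \<open>w\<close>.\<close>
  have x_lim: "(x j \<longlongrightarrow> a j) (at 0)" for j
    using x_cont[of j] by (simp add: isCont_def x_def a_def skew_product_funpow_invariant_line[of g, OF g0])
  have "\<forall>\<^sub>F w in at 0. (g ^^ m) w \<noteq> 0"
    by (rule eventually_funpow_nonzero[OF g g0])
  moreover have "\<forall>\<^sub>F w in at 0. cmod w < e"
    using e by (auto simp: eventually_at)
  moreover have "\<forall>\<^sub>F w in at 0. cmod ((g ^^ n) w) < 1"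
  proof -
    have "isCont (g ^^ n) 0"
      using continuous_on_funpow[OF cont(2)] by (simp add: continuous_on_eq_continuous_at)
    moreover have "(g ^^ n) 0 = 0"
      by (induction n) (auto simp: g0)
    ultimately have "(\<lambda>w. cmod ((g ^^ n) w)) \<midarrow>0\<rightarrow> 0"
      using tendsto_norm[of "g ^^ n" 0 "at 0"] by (simp add: isCont_def)
    then show ?thesis by (rule order_tendstoD) simp
  qed
  moreover have "\<forall>\<^sub>F w in at 0. R' < cmod (x m w)"
    using order_tendstoD(1)[OF tendsto_norm[OF x_lim] am] .
  moreover have "\<forall>\<^sub>F w in at 0. \<forall>j\<in>{..<m}. x m w - x j w \<noteq> 0"
  proof (rule eventually_ball_finite, simp, intro ballI)
    fix j assume "j \<in> {..<m}"
    then have "a m - a j \<noteq> 0"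
      using inj by (auto dest: injD)
    then show "\<forall>\<^sub>F w in at 0. x m w - x j w \<noteq> 0"
      by (rule tendsto_imp_eventually_ne[OF tendsto_diff[OF x_lim x_lim]])
  qed
  ultimately have "\<forall>\<^sub>F w in at 0. (g ^^ m) w \<noteq> 0 \<and> cmod w < e \<and> cmod ((g ^^ n) w) < 1 \<and>
      R' < cmod (x m w) \<and> (\<forall>j\<in>{..<m}. x m w - x j w \<noteq> 0)"
    by eventually_elim auto
  then obtain w where w: "(g ^^ m) w \<noteq> 0" "cmod w < e" "cmod ((g ^^ n) w) < 1"
    "R' < cmod (x m w)" "\<And>j. j < m \<Longrightarrow> x m w \<noteq> x j w"
    using eventually_happens[of _ "at (0::complex)"] by fastforce
  have fin: "finite (T \<union> (\<lambda>j. x j w) ` {..<m})"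
    using T by simp
  have notin: "x m w \<notin> T \<union> (\<lambda>j. x j w) ` {..<m}"
    using w(4,5) R'(3) by (force simp: not_less)
  \<comment> \<open>With \<open>y = x m w\<close>, the prescribed value solves
    \<open>f y + (g ^^ m) w * (h y + p y) = 0\<close> for \<open>p y\<close>; this is where
    \<open>(g ^^ m) w\<close> must be nonzero.\<close>
  obtain p where p: "p holomorphic_on UNIV"
    "\<And>y. y \<in> T \<union> (\<lambda>j. x j w) ` {..<m} \<Longrightarrow> p y = 0"
    "p (x m w) = - f (x m w) / (g ^^ m) w - h (x m w)"
    "\<And>y. cmod y \<le> R' \<Longrightarrow> cmod (p y) \<le> e"
    by (rule small_polynomial_interpolation[OF fin notin less_imp_le[OF R'(1)] w(4) e,
          where v = "- f (x m w) / (g ^^ m) w - h (x m w)"]) (rule that)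
  let ?h' = "\<lambda>y. h y + p y"
  \<comment> \<open>\<open>p\<close> vanishes at the points visited before time \<open>m\<close>, so
    the correction first acts in the step from \<open>m\<close> to \<open>n = Suc m\<close>.\<close>
  have orbit: "(?F ^^ m) (z, w) = (skew_product f g ?h' ^^ m) (z, w)"
    by (rule skew_product_funpow_cong) (use p(2) in \<open>auto simp: x_def\<close>)
  show thesis
  proof
    show "?h' holomorphic_on UNIV" by (intro holomorphic_intros h p)
    show "h y + p y = h y" if "y \<in> T" for y using p(2) that by simp
    show "cmod (h y + p y - h y) \<le> e" if "cmod y \<le> R" for y using p(4)[of y] that R'(2) by simp
    show "cmod w < e" "cmod ((g ^^ n) w) \<le> 1" using w by auto
    show "R \<le> cmod ((f ^^ n) z)" using n R' by (simp add: a_def)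
    show "fst ((skew_product f g ?h' ^^ n) (z, w)) = 0"
      unfolding m skew_product_funpow_Suc orbit[symmetric]
      using p(3) w(1) by (simp add: x_def)
  qed
qed

section \<open>Limit of the successive corrections\<close>

lemma exists_skew_product_orbits_hitting_zero:
  fixes f g :: "complex \<Rightarrow> complex"
  assumes f: "f holomorphic_on UNIV" and g: "g holomorphic_on UNIV" "\<not> g constant_on UNIV"
    and g0: "g 0 = 0"
    and unb: "\<not> bounded (range (\<lambda>n. (f ^^ n) z))"
  obtains h where "h holomorphic_on UNIV"
    "\<And>k. \<exists>n w. cmod w \<le> (1/2) ^ k \<and> real k \<le> cmod ((f ^^ n) z) \<and> cmod ((g ^^ n) w) \<le> 1 \<and>
        fst ((skew_product f g h ^^ n) (z, w)) = 0"
proof -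
  \<comment> \<open>The set \<open>T\<close> records the points at which the orbit evaluates
    \<open>h\<close>: the property survives every later change of \<open>h\<close> that keeps its
    values on \<open>T\<close>.\<close>
  define good where "good = (\<lambda>k h T. \<exists>n w. cmod w \<le> (1/2) ^ k \<and> real k \<le> cmod ((f ^^ n) z) \<and>
    cmod ((g ^^ n) w) \<le> 1 \<and> fst ((skew_product f g h ^^ n) (z, w)) = 0 \<and>
    (\<forall>j<n. fst ((skew_product f g h ^^ j) (z, w)) \<in> T))"
  define ok where "ok = (\<lambda>x :: (complex \<Rightarrow> complex) \<times> complex set. fst x holomorphic_on UNIV \<and> finite (snd x))"
  define step where "step = (\<lambda>k (x :: (complex \<Rightarrow> complex) \<times> complex set) (y :: (complex \<Rightarrow> complex) \<times> complex set).
      (\<forall>t\<in>snd x. fst y t = fst x t) \<and> snd x \<subseteq> snd y \<and>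
      (\<forall>t. cmod t \<le> real k \<longrightarrow> cmod (fst y t - fst x t) \<le> (1/2) ^ k) \<and> good k (fst y) (snd y))"
  have "\<exists>y. ok y \<and> step k x y"
    if hx: "ok x" for x k
  proof -
    obtain h' n w where h': "h' holomorphic_on UNIV" "\<And>t. t \<in> snd x \<Longrightarrow> h' t = fst x t"
      "\<And>t. cmod t \<le> real k \<Longrightarrow> cmod (h' t - fst x t) \<le> (1/2) ^ k"
      "cmod w < (1/2) ^ k" "real k \<le> cmod ((f ^^ n) z)" "cmod ((g ^^ n) w) \<le> 1"
      "fst ((skew_product f g h' ^^ n) (z, w)) = 0"
      using perturb_orbit_to_zero[OF f g g0 unb, of "fst x" "snd x" "(1/2) ^ k" "real k"] hx
      unfolding ok_def
      by (smt (verit, best) divide_pos_pos zero_less_power)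
    let ?T = "snd x \<union> (\<lambda>j. fst ((skew_product f g h' ^^ j) (z, w))) ` {..<n}"
    have "good k h' ?T"
      unfolding good_def using h'(4-7) by (intro exI[of _ n] exI[of _ w]) auto
    then show ?thesis
      unfolding ok_def step_def using h'(1-3) hx[unfolded ok_def]
      by (intro exI[of _ "(h', ?T)"]) auto
  qed
  moreover have "\<exists>x. ok x"
    unfolding ok_def by (intro exI[of _ "(\<lambda>_. 0, {})"]) auto
  ultimately obtain s where s: "\<And>k. ok (s k)" "\<And>k. step k (s k) (s (Suc k))"
    using dependent_nat_choice[of "\<lambda>_. ok" step] by metis
  note s = s[unfolded ok_def step_def]
  define H where "H = (\<lambda>k. fst (s k))"
  \<comment> \<open>Telescoping turns convergence of \<open>H\<close> into convergence of a series,
    to which the Weierstrass test applies.\<close>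
  define d where "d = (\<lambda>k t. H (Suc k) t - H k t)"
  have H_sum: "(\<Sum>i<k. d i t) = H k t - H 0 t" for k t
    by (induction k) (auto simp: d_def)
  have unif: "uniformly_convergent_on (cball 0 R) H" for R
  proof -
    have "uniformly_convergent_on (cball 0 R) (\<lambda>k t. \<Sum>i<k. d i t)"
    proof (rule Weierstrass_m_test'_ev)
      \<comment> \<open>From the index \<open>nat \<lceil>R\<rceil>\<close> on,
        \<open>cball 0 R\<close> lies in the disc of radius \<open>i\<close>, where stage
        \<open>i\<close> changes \<open>H\<close> by at most \<open>(1/2) ^ i\<close>.\<close>
      show "\<forall>\<^sub>F i in sequentially. \<forall>t\<in>cball 0 R. norm (d i t) \<le> (1/2) ^ i"
      proof (rule eventually_sequentiallyI[of "nat \<lceil>R\<rceil>"], intro ballI)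
        fix i and t :: complex assume "nat \<lceil>R\<rceil> \<le> i" "t \<in> cball 0 R"
        then have "cmod t \<le> real i" by (simp; linarith)
        then show "norm (d i t) \<le> (1/2) ^ i"
          using s(2)[of i] by (simp add: d_def H_def)
      qed
      show "summable (\<lambda>i. (1/2::real) ^ i)" by (intro summable_geometric) auto
    qed
    then obtain l where "uniform_limit (cball 0 R) (\<lambda>k t. H k t - H 0 t) l sequentially"
      unfolding H_sum uniformly_convergent_on_def by blast
    from uniform_limit_add[OF this uniform_limit_const]
    have "uniform_limit (cball 0 R) (\<lambda>k t. H k t - H 0 t + H 0 t) (\<lambda>t. l t + H 0 t) sequentially" .
    then have "uniform_limit (cball 0 R) H (\<lambda>t. l t + H 0 t) sequentially"
      by simp
    then show ?thesis by (auto simp: uniformly_convergent_on_def)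
  qed
  define h where "h = (\<lambda>t. lim (\<lambda>k. H k t))"
  have unif_h: "uniform_limit (cball 0 R) H h sequentially" for R
    using unif[of R] unfolding h_def by (simp add: uniformly_convergent_uniform_limit_iff)
  have "h holomorphic_on UNIV"
  proof (rule holomorphic_uniform_sequence[of UNIV H])
    fix t :: complex
    have "cball t 1 \<subseteq> cball 0 (cmod t + 1)"
      by (rule cball_subset_cball_iff[THEN iffD2]) simp
    then show "\<exists>e>0. cball t e \<subseteq> UNIV \<and> uniform_limit (cball t e) H h sequentially"
      using uniform_limit_on_subset[OF unif_h] by (intro exI[of _ 1]) auto
  qed (use s(1) in \<open>auto simp: H_def\<close>)
  moreover have "\<exists>n w. cmod w \<le> (1/2) ^ k \<and> real k \<le> cmod ((f ^^ n) z) \<and> cmod ((g ^^ n) w) \<le> 1 \<and>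
        fst ((skew_product f g h ^^ n) (z, w)) = 0" for k
  proof -
    \<comment> \<open>A recorded point stays recorded and no later stage changes the value there, so
      the sequence defining \<open>h t\<close> is constant from index \<open>i\<close> on.\<close>
    have stable: "h t = H i t" if "t \<in> snd (s i)" for t i
    proof -
      have "t \<in> snd (s (i + j)) \<and> H (i + j) t = H i t" for j
      proof (induction j)
        case (Suc j)
        then have "t \<in> snd (s (i + j))" "H (i + j) t = H i t"
          by auto
        moreover have "fst (s (Suc (i + j))) t = fst (s (i + j)) t" "t \<in> snd (s (Suc (i + j)))"
          using s(2)[of "i + j"] calculation(1) by blast+
        ultimately show ?case
          by (simp add: H_def)
      qed (use that in simp)
      then have "(\<lambda>j. H (j + i) t) \<longlonglongrightarrow> H i t"
        by (simp add: add.commute)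
      then have "(\<lambda>j. H j t) \<longlonglongrightarrow> H i t" by (rule LIMSEQ_offset)
      then show ?thesis by (simp add: h_def limI)
    qed
    obtain n w where nw: "cmod w \<le> (1/2) ^ k" "real k \<le> cmod ((f ^^ n) z)" "cmod ((g ^^ n) w) \<le> 1"
      "fst ((skew_product f g (H (Suc k)) ^^ n) (z, w)) = 0"
      "\<And>j. j < n \<Longrightarrow> fst ((skew_product f g (H (Suc k)) ^^ j) (z, w)) \<in> snd (s (Suc k))"
      using s(2)[of k] unfolding good_def H_def by blast
    have "(skew_product f g (H (Suc k)) ^^ n) (z, w) = (skew_product f g h ^^ n) (z, w)"
      by (rule skew_product_funpow_cong) (simp add: stable[OF nw(5)])
    then show ?thesis using nw by (intro exI[of _ n] exI[of _ w]) auto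
  qed
  ultimately show thesis by (rule that)
qed

section \<open>An obstruction to compact convergence\<close>

text \<open>On a closed ball about \<open>p\<close> the limit \<open>\<phi>\<close> is continuous,
  so \<open>s n p\<close> and \<open>s n (q n)\<close> both tend to \<open>\<phi> p\<close>. A fixed
  gap between these values therefore excludes a compact limit.\<close>

lemma compact_limit_dist_tendsto_0:
  fixes s :: "nat \<Rightarrow> 'a::heine_borel \<Rightarrow> 'b::metric_space"
  assumes lim: "compact_limit V s \<phi>" and V: "open V" "p \<in> V"
    and cont: "\<And>n. continuous_on UNIV (s n)" and q: "q \<longlonglongrightarrow> p"
  shows "(\<lambda>n. dist (s n p) (s n (q n))) \<longlonglongrightarrow> 0"
proof -
  obtain e where e: "e > 0" "cball p e \<subseteq> V"
    using V open_contains_cball by blast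
  have unif: "uniform_limit (cball p e) s \<phi> sequentially"
    using lim e unfolding compact_limit_def by auto
  have "continuous_on (cball p e) \<phi>"
    by (rule uniform_limit_theorem[OF always_eventually unif]) (auto intro: continuous_on_subset[OF cont])
  then have "isCont \<phi> p"
    using e by (intro continuous_on_interior[of "cball p e"] interiorI[of "ball p e"]) auto
  then have \<phi>q: "(\<lambda>n. \<phi> (q n)) \<longlonglongrightarrow> \<phi> p"
    using isCont_tendsto_compose q by blast
  have sq: "(\<lambda>n. s n (q n)) \<longlonglongrightarrow> \<phi> p"
  proof (rule tendstoI)
    fix d :: real assume d: "0 < d"
    have "\<forall>\<^sub>F n in sequentially. \<forall>x\<in>cball p e. dist (s n x) (\<phi> x) < d / 2"
      by (rule uniform_limitD[OF unif half_gt_zero[OF d]])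
    moreover have "\<forall>\<^sub>F n in sequentially. dist (\<phi> (q n)) (\<phi> p) < d / 2"
      by (rule tendstoD[OF \<phi>q half_gt_zero[OF d]])
    moreover have "\<forall>\<^sub>F n in sequentially. dist (q n) p < e"
      by (rule tendstoD[OF q e(1)])
    ultimately show "\<forall>\<^sub>F n in sequentially. dist (s n (q n)) (\<phi> p) < d"
    proof eventually_elim
      case (elim n)
      then have "dist (s n (q n)) (\<phi> (q n)) < d / 2"
        by (simp add: dist_commute)
      with elim(2) show ?case
        by (metis dist_commute dist_triangle_half_l)
    qed
  qed
  have "(\<lambda>n. s n p) \<longlonglongrightarrow> \<phi> p"
    using tendsto_uniform_limitI[OF unif] e by auto
  from tendsto_dist[OF this sq] show ?thesis by simp
qed

section \<open>Embeddings into the sphere and the projective plane\<close>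

lemma continuous_on_Fin: "continuous_on UNIV Fin"
proof -
  have pos: "1 + (cmod z)\<^sup>2 \<noteq> 0" "(cmod z)\<^sup>2 + 1 \<noteq> 0" for z
    by (smt (verit) zero_le_power2)+
  have "continuous_on UNIV (\<lambda>z. stereo (Fin z))"
    unfolding stereo.simps by (intro continuous_intros) (use pos in auto)
  then show ?thesis
    unfolding continuous_on_iff by (simp add: dist_sphere_def)
qed

text \<open>The height coordinate of \<open>stereo\<close> is nonnegative outside the open unit disc
  and equals -1 at \<open>Fin 0\<close>.\<close>

lemma dist_Fin_0_ge:
  assumes "1 \<le> cmod a"
  shows "1 \<le> dist (Fin a) (Fin 0)"
proof -
  have "1 \<le> (cmod a)\<^sup>2" using assms by simp
  then have "0 \<le> ((cmod a)\<^sup>2 - 1) / ((cmod a)\<^sup>2 + 1)" by simp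
  then have "1 \<le> dist (snd (stereo (Fin a))) (snd (stereo (Fin 0)))"
    by (simp add: dist_real_def)
  also have "\<dots> \<le> dist (stereo (Fin a)) (stereo (Fin 0))" by (rule dist_snd_le)
  finally show ?thesis by (simp add: dist_sphere_def)
qed

text \<open>Continuity of \<open>affine_point\<close> and lower bounds for distances in
  \<open>cp2\<close> are read off from these matrix entries.\<close>

lemma line_projection_affine_point:
  "line_projection (affine_point (z, w)) $ i $ j =
     vector [1, z, w] $ i * cnj (vector [1, z, w] $ j) / of_real (1 + (cmod z)\<^sup>2 + (cmod w)\<^sup>2)"
proof -
  let ?v = "vector [1, z, w] :: complex ^ 3"
  have "?v \<noteq> 0"
    by (metis vector_3(1) zero_index zero_neq_one)
  moreover have "(norm ?v)\<^sup>2 = 1 + (cmod z)\<^sup>2 + (cmod w)\<^sup>2"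
    by (simp add: norm_vec_def L2_set_def sum_3 vector_3)
  ultimately show ?thesis
    unfolding affine_point_def
    by (subst case_prod_conv, subst line_projection.abs_eq) (auto intro!: exI[of _ 1])
qed

lemma continuous_on_affine_point: "continuous_on UNIV affine_point"
proof -
  have "1 + (cmod z)\<^sup>2 + (cmod w)\<^sup>2 \<noteq> 0" for z w
    by (smt (verit) zero_le_power2)
  then have nz: "complex_of_real (1 + (cmod z)\<^sup>2 + (cmod w)\<^sup>2) \<noteq> 0" for z w
    by (metis of_real_eq_0_iff)
  have v: "continuous_on UNIV (\<lambda>p. (vector [1, fst p, snd p] :: complex ^ 3) $ i)" for i
    using exhaust_3[of i]
    by (elim disjE) (simp_all add: vector_3 continuous_on_fst continuous_on_snd)
  have "continuous_on UNIV (\<lambda>p. line_projection (affine_point (fst p, snd p)) $ i $ j)" for i j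
    unfolding line_projection_affine_point
    by (intro continuous_intros v) (use nz in auto)
  then have "continuous_on UNIV (\<lambda>p. \<chi> i j. line_projection (affine_point p) $ i $ j)"
    by (intro continuous_on_vec_lambda) simp
  then show ?thesis
    unfolding continuous_on_iff by (simp add: dist_cp2_def)
qed

text \<open>The diagonal entry belonging to the first affine coordinate is at least 1/2 at
  \<open>(a, 0)\<close> and vanishes at \<open>(0, b)\<close>; the Frobenius distance dominates this
  difference.\<close>

lemma dist_affine_point_ge:
  assumes "1 \<le> cmod a"
  shows "1 / 2 \<le> dist (affine_point (a, 0)) (affine_point (0, b))"
proof -
  let ?A = "line_projection (affine_point (a, 0))" and ?B = "line_projection (affine_point (0, b))"
  have a: "1 \<le> (cmod a)\<^sup>2" using assms by simp
  have A: "?A $ 2 $ 2 = of_real ((cmod a)\<^sup>2 / (1 + (cmod a)\<^sup>2))"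
    unfolding line_projection_affine_point vector_3 by (simp add: complex_norm_square flip: of_real_power)
  have B: "?B $ 2 $ 2 = 0"
    unfolding line_projection_affine_point vector_3 by simp
  have "1 / 2 \<le> (cmod a)\<^sup>2 / (1 + (cmod a)\<^sup>2)"
    using a by (simp add: divide_simps)
  also have "\<dots> = dist (?A $ 2 $ 2) (?B $ 2 $ 2)"
    unfolding A B dist_norm by (simp only: diff_0_right norm_of_real) simp
  also have "\<dots> \<le> dist (?A $ 2) (?B $ 2)" by (rule dist_vec_nth_le)
  also have "\<dots> \<le> dist ?A ?B" by (rule dist_vec_nth_le)
  finally show ?thesis by (simp add: dist_cp2_def)
qed

section \<open>Failure of normality at \<open>(z0, 0)\<close>\<close>

theorem corollary1p2:
  fixes f g :: "complex \<Rightarrow> complex" and U :: "complex set"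
  assumes "f holomorphic_on UNIV" and "\<not> f constant_on UNIV"
    and "g holomorphic_on UNIV" and "\<not> g constant_on UNIV"
    and "g 0 = 0" and "0 \<in> Fatou_set sphere_normal g"
    and "U \<in> components (Fatou_set sphere_normal f)"
    and "\<exists>z0\<in>U. \<exists>n :: nat \<Rightarrow> nat. strict_mono n \<and>
           filterlim (\<lambda>k. (f ^^ n k) z0) at_infinity sequentially"
  shows "\<exists>h :: complex \<Rightarrow> complex. h holomorphic_on UNIV \<and>
           (let F = (\<lambda>(z, w). (f z + w * h z, g w)) in
              \<not> bulging C2hat_normal F U \<and>
              \<not> bulging P2_normal F U \<and>
              \<not> bulging Chat2_normal F U)"
proof -
  obtain z0 m where z0: "z0 \<in> U" and lim: "filterlim (\<lambda>k. (f ^^ m k) z0) at_infinity sequentially"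
    using assms(8) by blast
  have unb: "\<not> bounded (range (\<lambda>n. (f ^^ n) z0))"
  proof
    assume "bounded (range (\<lambda>n. (f ^^ n) z0))"
    then obtain B where B: "\<And>n. cmod ((f ^^ n) z0) \<le> B"
      by (auto simp: bounded_iff)
    have "filterlim (\<lambda>k. cmod ((f ^^ m k) z0)) at_top sequentially"
      using lim filterlim_at_infinity_imp_norm_at_top by blast
    then have "\<forall>\<^sub>F k in sequentially. B + 1 \<le> cmod ((f ^^ m k) z0)"
      by (simp add: filterlim_at_top)
    then obtain k where "B + 1 \<le> cmod ((f ^^ m k) z0)"
      using eventually_happens'[OF sequentially_bot] by blast
    then show False using B[of "m k"] by simp
  qed
  obtain h where h: "h holomorphic_on UNIV"
    and orb: "\<And>k. \<exists>n w. cmod w \<le> (1/2) ^ k \<and> real k \<le> cmod ((f ^^ n) z0) \<and> cmod ((g ^^ n) w) \<le> 1 \<and>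
        fst ((skew_product f g h ^^ n) (z0, w)) = 0"
    using exists_skew_product_orbits_hitting_zero[OF assms(1,3,4,5) unb] by metis
  define F where "F = skew_product f g h"
  obtain n w where nw: "\<And>k. cmod (w k) \<le> (1/2) ^ k" "\<And>k. real k \<le> cmod ((f ^^ n k) z0)"
     "\<And>k. cmod ((g ^^ n k) (w k)) \<le> 1" "\<And>k. fst ((F ^^ n k) (z0, w k)) = 0"
    using orb unfolding F_def by metis
  define s where "s = (\<lambda>k. F ^^ n k)"
  define p where "p = (z0, 0 :: complex)"
  define q where "q = (\<lambda>k. (z0, w k))"
  have sp: "s k p = ((f ^^ n k) z0, 0)" for k
    unfolding s_def p_def F_def by (rule skew_product_funpow_invariant_line) fact
  have sq: "s k (q k) = (0, (g ^^ n k) (w k))" for k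
    using nw(4)[of k] snd_skew_product_funpow[of "n k" f g h "q k"]
    by (simp add: s_def q_def F_def prod_eq_iff)
  have s_cont: "continuous_on UNIV (s k)" for k
    unfolding s_def F_def
    by (intro continuous_on_funpow continuous_on_skew_product holomorphic_on_imp_continuous_on assms h)
  have "w \<longlonglongrightarrow> 0"
    by (rule Lim_null_comparison[OF _ LIMSEQ_power_zero[of "1/2::real"]]) (use nw(1) in auto)
  then have q_lim: "q \<longlonglongrightarrow> p"
    unfolding q_def p_def by (intro tendsto_Pair tendsto_const)
  \<comment> \<open>Normality is tested on arbitrary sequences in the family of iterates, so the
    times \<open>n k\<close> may come in any order.\<close>
  have range: "range s \<subseteq> range (\<lambda>n. F ^^ n)"
    by (auto simp: s_def)
  have large: "\<forall>\<^sub>F k in sequentially. R \<le> cmod ((f ^^ n (r k)) z0)" if "strict_mono r" for r R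
  proof (rule eventually_sequentiallyI[of "nat \<lceil>R\<rceil>"])
    fix k assume "nat \<lceil>R\<rceil> \<le> k"
    then show "R \<le> cmod ((f ^^ n (r k)) z0)"
      using nw(2)[of "r k"] seq_suble[OF that, of k] by linarith
  qed
  \<comment> \<open>One argument serves all three notions: \<open>\<pi>\<close> maps C^2 to the
    target space, and \<open>e\<close> is a uniform gap there between the images of
    \<open>(a, 0)\<close> with \<open>1 \<le> cmod a\<close> and of the line of points
    \<open>(0, b)\<close>.\<close>
  have key: False if "open V" "p \<in> V" "strict_mono r" "0 < e"
      "compact_limit V (\<lambda>k x. \<pi> (s (r k) x)) \<phi>" "continuous_on UNIV \<pi>"
      "\<And>a b. 1 \<le> cmod a \<Longrightarrow> e \<le> dist (\<pi> (a, 0)) (\<pi> (0, b))"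
    for V r e \<phi> and \<pi> :: "complex \<times> complex \<Rightarrow> 'b::metric_space"
  proof -
    have "(\<lambda>k. q (r k)) \<longlonglongrightarrow> p"
      using LIMSEQ_subseq_LIMSEQ[OF q_lim that(3)] by (simp add: o_def)
    then have "(\<lambda>k. dist (\<pi> (s (r k) p)) (\<pi> (s (r k) (q (r k))))) \<longlonglongrightarrow> 0"
      by (intro compact_limit_dist_tendsto_0[OF that(5,1,2)] continuous_on_compose2[OF that(6) s_cont]) auto
    then have "\<forall>\<^sub>F k in sequentially. dist (\<pi> (s (r k) p)) (\<pi> (s (r k) (q (r k)))) < e"
      using that(4) by (intro order_tendstoD)
    then have "\<forall>\<^sub>F k in sequentially. False"
      using large[OF that(3), of 1]
      by eventually_elim (use that(7) in \<open>auto simp only: sp sq not_le[symmetric]\<close>)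
    then show False by simp
  qed
  have "p \<in> U \<times> {0}" using z0 by (simp add: p_def)
  then have nb: "\<not> bulging nrml F U" if "\<And>V. open V \<Longrightarrow> p \<in> V \<Longrightarrow> \<not> nrml V (range (\<lambda>n. F ^^ n))" for nrml
    unfolding bulging_def Fatou_set_def using that by blast
  have "\<not> bulging C2hat_normal F U"
  proof (rule nb, rule notI)
    fix V assume V: "open V" "p \<in> V" and "C2hat_normal V (range (\<lambda>n. F ^^ n))"
    then consider "compactly_divergent V s"
      | r \<phi> where "strict_mono r" "compact_limit V (\<lambda>n. s (r n)) \<phi>"
      unfolding C2hat_normal_def using range by blast
    then show False
    proof cases
      \<comment> \<open>The points \<open>q k\<close> refute divergence: they enter the ball about
        \<open>p\<close>, while \<open>s k (q k)\<close> has norm at most 1.\<close>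
      case 1
      obtain e where e: "e > 0" "cball p e \<subseteq> V"
        using V open_contains_cball by blast
      then have "\<forall>\<^sub>F k in sequentially. \<forall>x\<in>cball p e. norm (s k x) > 1"
        using 1 unfolding compactly_divergent_def by auto
      moreover have "\<forall>\<^sub>F k in sequentially. dist (q k) p < e"
        using tendstoD[OF q_lim e(1)] .
      ultimately have "\<forall>\<^sub>F k in sequentially. norm (s k (q k)) > 1"
        by eventually_elim (auto simp: dist_commute)
      then show False
        using nw(3) by (auto simp: sq norm_Pair eventually_sequentially not_less[symmetric])
    next
      case 2
      \<comment> \<open>Here \<open>\<pi>\<close> is the identity; the first coordinates
        \<open>a\<close> and 0 are already at distance at least 1.\<close>
      show False
        by (rule key[OF V 2(1) zero_less_one, of "\<lambda>x. x"])
          (use 2(2) in \<open>auto intro: order.trans[OF _ dist_fst_le]\<close>)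
    qed
  qed
  moreover have "\<not> bulging P2_normal F U"
  proof (rule nb, rule notI)
    fix V assume V: "open V" "p \<in> V" and "P2_normal V (range (\<lambda>n. F ^^ n))"
    then obtain r \<phi> where "strict_mono r" "compact_limit V (\<lambda>n x. affine_point (s (r n) x)) \<phi>"
      unfolding P2_normal_def using range by blast
    then show False
      by (intro key[OF V _ _ _ continuous_on_affine_point dist_affine_point_ge]) auto
  qed
  moreover have "\<not> bulging Chat2_normal F U"
  proof (rule nb, rule notI)
    fix V assume V: "open V" "p \<in> V" and "Chat2_normal V (range (\<lambda>n. F ^^ n))"
    then obtain r \<phi> where r: "strict_mono r" "compact_limit V (\<lambda>n x. map_prod Fin Fin (s (r n) x)) \<phi>"
      unfolding Chat2_normal_def using range by blast
    have "continuous_on UNIV (map_prod Fin Fin)"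
      unfolding map_prod_def split_beta
      by (intro continuous_intros continuous_on_compose2[OF continuous_on_Fin]) auto
    moreover have "1 \<le> dist (map_prod Fin Fin (a, 0)) (map_prod Fin Fin (0, b))" if "1 \<le> cmod a" for a b
      using dist_Fin_0_ge[OF that] dist_fst_le[of "map_prod Fin Fin (a, 0)" "map_prod Fin Fin (0, b)"]
      by simp
    ultimately show False
      by (intro key[OF V r(1) zero_less_one r(2)])
  qed
  ultimately show ?thesis
    using h by (auto simp: F_def skew_product_def intro!: exI[of _ h])
qed

end
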